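(* Suppose $(S,\to,\twoheadrightarrow,\hookrightarrow)$ is a two-acyclic factorization system that obeys the image condition. The map $x\mapsto(T(x),T(x)^\perp)$ is an isomorphism from the transitive closure of $\rightsquigarrow$ on $S$ to the cover-determined forcing preorder on $\operatorname{Ji}^c(\operatorname{Pairs}(\to))$. This map induces an isomorphism from the poset of $\rightsquigarrow$-downsets under containment to the lattice $\operatorname{Con}^{cc}(\operatorname{Pairs}(\to))$.
   Context: For a binary relation $\to$ on a set $S$ and $X\subseteq S$, put $X^\perp=\{y\in S: x\not\to y\ \forall x\in X\}$ and ${}^\perp X=\{y\in S: y\not\to x\ \forall x\in X\}$. A maximal orthogonal pair is a pair $(X,Y)$ of subsets of $S$ with $Y=X^\perp$ and $X={}^\perp Y$. $\operatorname{Pairs}(\to)$ is the complete lattice of maximal orthogonal pairs, partially ordered by containment of first components. For a reflexive relation $\to$ on $S$, $\operatorname{Fact}(\to)=(\twoheadrightarrow,\hookrightarrow)$, where $x\twoheadrightarrow y$ iff for all $z$, $y\to z$ implies $x\to z$, and $x\hookrightarrow y$ iff for all $z$, $z\to x$ implies $z\to y$. For preorders $\twoheadrightarrow,\hookrightarrow$ on $S$, $\operatorname{Mult}(\twoheadrightarrow,\hookrightarrow)$ is the relation relating $x$ to $z$ iff there is $y\in S$ with $x\twoheadrightarrow y\hookrightarrow z$. A factorization system is a tuple $(S,\to,\twoheadrightarrow,\hookrightarrow)$ ($S$ possibly infinite) with $\to$ reflexive, $\operatorname{Fact}(\to)=(\twoheadrightarrow,\hookrightarrow)$ and $\operatorname{Mult}(\twoheadrightarrow,\hookrightarrow)=\to$.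 It is two-acyclic if $x\twoheadrightarrow y\twoheadrightarrow x$ implies $x=y$, $x\hookrightarrow y\hookrightarrow x$ implies $x=y$, and $x\twoheadrightarrow y\hookrightarrow x$ implies $x=y$. Convention: $x\twoheadrightarrow y$ or $x\hookrightarrow y$ is read as "$x$ is greater than or equal to $y$"; thus $x$ is $\twoheadrightarrow$-minimal in $A\ni x$ if there is no $x'\in A\setminus\{x\}$ with $x\twoheadrightarrow x'$, and $\hookrightarrow$-maximal in $A$ if there is no $x'\in A\setminus\{x\}$ with $x'\hookrightarrow x$. For $y\in S$, $T(y)=\{x'\in S: y\twoheadrightarrow x'\}$, $T_*(y)=T(y)\setminus\{y\}$, and $F(y)=\{x'\in S: x'\hookrightarrow y\}$. The relation $\rightsquigarrow$ on $S$: $x\rightsquigarrow y$ iff either $x$ is $\twoheadrightarrow$-minimal in $F(y)$ or $x$ is $\hookrightarrow$-maximal in $T(y)$. A $\rightsquigarrow$-downset is a subset $D\subseteq S$ such that $x\in D$ and $x\rightsquigarrow y$ imply $y\in D$. For $x\to z$, an image of $x\to z$ is a $\twoheadrightarrow$-minimal element of $\{y\in S: x\twoheadrightarrow y\hookrightarrow z\}$, and a co-image is a $\hookrightarrow$-maximal element of this set. The image condition: for all $x,z\in S$ with $x\to z$ there is at least one image and at least one co-image of $x\to z$. An element $j$ of a complete lattice $L$ is completely join-irreducible if $j=\bigvee X$ implies $j\in X$ for all $X\subseteq L$; $\operatorname{Ji}^cL$ is the set of these. The completely join-irreducible elements of $\operatorname{Pairs}(\to)$ are exactly the pairs $(T(x),T(x)^\perp)$,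 $x\in S$, and the unique element covered by $(T(x),T(x)^\perp)$ is $(T_*(x),T_*(x)^\perp)$. A congruence on a complete lattice is complete if it respects arbitrary nonempty meets and joins. A congruence $\Theta$ is cover-determined if, whenever $x\le y$ and $u\equiv v\bmod\Theta$ for all covers $u\lessdot v$ with $x\le u\lessdot v\le y$, then $x\equiv y\bmod\Theta$. $\Theta$ contracts a cover $a\lessdot b$ if $a\equiv b\bmod\Theta$. $\operatorname{Con}^{cc}(L)$ is the set of complete cover-determined congruences of $L$ under refinement order (finer is smaller); it is a complete lattice. The cover-determined forcing preorder on $\operatorname{Ji}^c(\operatorname{Pairs}(\to))$: $(T(x),T(x)^\perp)$ forces $(T(y),T(y)^\perp)$ iff every complete cover-determined congruence contracting $(T_*(x),T_*(x)^\perp)\lessdot(T(x),T(x)^\perp)$ also contracts $(T_*(y),T_*(y)^\perp)\lessdot(T(y),T(y)^\perp)$. The first isomorphism means a bijection such that $x$ is related to $y$ by the transitive closure of $\rightsquigarrow$ iff $(T(x),T(x)^\perp)$ forces $(T(y),T(y)^\perp)$. The induced map takes a downset $D$ to the complete cover-determined congruence for which $D$ is exactly the set of $x\in S$ such that $(T_*(x),T_*(x)^\perp)\lessdot(T(x),T(x)^\perp)$ is contracted. *)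

theory Defs
  imports "HOL-Algebra.Complete_Lattice"
begin

text \<open>
  Congruences are sets of pairs, so that \<open>\<Theta>\<close> refines \<open>\<Psi>\<close> iff \<open>\<Theta> \<subseteq> \<Psi>\<close>.
\<close>

definition covered_by :: "('a, 'b) gorder_scheme \<Rightarrow> 'a \<Rightarrow> 'a \<Rightarrow> bool" where
  "covered_by L a b \<longleftrightarrow>
     a \<in> carrier L \<and> b \<in> carrier L \<and> a \<sqsubset>\<^bsub>L\<^esub> b \<and>
     \<not> (\<exists>c\<in>carrier L. a \<sqsubset>\<^bsub>L\<^esub> c \<and> c \<sqsubset>\<^bsub>L\<^esub> b)"

text \<open>Taking \<open>X = {}\<close> shows that the least element does not belong to \<open>Ji_c L\<close>.\<close>

definition Ji_c :: "('a, 'b) gorder_scheme \<Rightarrow> 'a set" where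
  "Ji_c L = {j \<in> carrier L. \<forall>X. X \<subseteq> carrier L \<longrightarrow> j = \<Squnion>\<^bsub>L\<^esub> X \<longrightarrow> j \<in> X}"

definition lattice_congruence :: "('a, 'b) gorder_scheme \<Rightarrow> 'a rel \<Rightarrow> bool" where
  "lattice_congruence L \<Theta> \<longleftrightarrow>
     equiv (carrier L) \<Theta> \<and>
     (\<forall>x x' y y'. (x, x') \<in> \<Theta> \<longrightarrow> (y, y') \<in> \<Theta> \<longrightarrow>
        (x \<squnion>\<^bsub>L\<^esub> y, x' \<squnion>\<^bsub>L\<^esub> y') \<in> \<Theta> \<and> (x \<sqinter>\<^bsub>L\<^esub> y, x' \<sqinter>\<^bsub>L\<^esub> y') \<in> \<Theta>)"

text \<open>
  Two nonempty families \<open>x\<^sub>i \<equiv> y\<^sub>i\<close> over an arbitrary index set are encoded by the set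
  \<open>K\<close> of all pairs \<open>(x\<^sub>i, y\<^sub>i)\<close>, which avoids quantifying over index types.
\<close>

definition complete_congruence :: "('a, 'b) gorder_scheme \<Rightarrow> 'a rel \<Rightarrow> bool" where
  "complete_congruence L \<Theta> \<longleftrightarrow>
     lattice_congruence L \<Theta> \<and>
     (\<forall>K. K \<noteq> {} \<longrightarrow> K \<subseteq> \<Theta> \<longrightarrow>
        (\<Squnion>\<^bsub>L\<^esub> (fst ` K), \<Squnion>\<^bsub>L\<^esub> (snd ` K)) \<in> \<Theta> \<and>
        (\<Sqinter>\<^bsub>L\<^esub> (fst ` K), \<Sqinter>\<^bsub>L\<^esub> (snd ` K)) \<in> \<Theta>)"

definition cover_determined :: "('a, 'b) gorder_scheme \<Rightarrow> 'a rel \<Rightarrow> bool" where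
  "cover_determined L \<Theta> \<longleftrightarrow>
     (\<forall>x\<in>carrier L. \<forall>y\<in>carrier L. x \<sqsubseteq>\<^bsub>L\<^esub> y \<longrightarrow>
        (\<forall>u v. covered_by L u v \<longrightarrow> x \<sqsubseteq>\<^bsub>L\<^esub> u \<longrightarrow> v \<sqsubseteq>\<^bsub>L\<^esub> y \<longrightarrow> (u, v) \<in> \<Theta>) \<longrightarrow>
        (x, y) \<in> \<Theta>)"

definition Con_cc :: "('a, 'b) gorder_scheme \<Rightarrow> 'a rel gorder" where
  "Con_cc L = \<lparr>carrier = {\<Theta>. complete_congruence L \<Theta> \<and> cover_determined L \<Theta>},
               eq = (=), le = (\<subseteq>)\<rparr>"

definition contracts :: "('a, 'b) gorder_scheme \<Rightarrow> 'a rel \<Rightarrow> 'a \<Rightarrow> 'a \<Rightarrow> bool" where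
  "contracts L \<Theta> a b \<longleftrightarrow> covered_by L a b \<and> (a, b) \<in> \<Theta>"

text \<open>Only meaningful if \<open>j\<close> covers exactly one element, as members of \<open>Ji_c L\<close> do.\<close>

definition lower_cover :: "('a, 'b) gorder_scheme \<Rightarrow> 'a \<Rightarrow> 'a" where
  "lower_cover L j = (THE a. covered_by L a j)"

definition cd_forcing :: "('a, 'b) gorder_scheme \<Rightarrow> 'a rel" where
  "cd_forcing L =
     {(j, k). j \<in> Ji_c L \<and> k \<in> Ji_c L \<and>
        (\<forall>\<Theta>\<in>carrier (Con_cc L).
           contracts L \<Theta> (lower_cover L j) j \<longrightarrow> contracts L \<Theta> (lower_cover L k) k)}"

text \<open>
  In the following \<open>S\<close> is the ground set and \<open>arr\<close>, \<open>tw\<close>, \<open>hk\<close> are the relations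
  \<open>\<rightarrow>\<close>, \<open>\<twoheadrightarrow>\<close>, \<open>\<hookrightarrow>\<close> on \<open>S\<close>.
\<close>

definition rperp :: "'a set \<Rightarrow> 'a rel \<Rightarrow> 'a set \<Rightarrow> 'a set" where
  "rperp S arr X = {y \<in> S. \<forall>x\<in>X. (x, y) \<notin> arr}"

definition lperp :: "'a set \<Rightarrow> 'a rel \<Rightarrow> 'a set \<Rightarrow> 'a set" where
  "lperp S arr X = {y \<in> S. \<forall>x\<in>X. (y, x) \<notin> arr}"

definition Pairs :: "'a set \<Rightarrow> 'a rel \<Rightarrow> ('a set \<times> 'a set) gorder" where
  "Pairs S arr =
     \<lparr>carrier = {(X, Y). X \<subseteq> S \<and> Y \<subseteq> S \<and> Y = rperp S arr X \<and> X = lperp S arr Y},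
      eq = (=), le = (\<lambda>p q. fst p \<subseteq> fst q)\<rparr>"

definition Fact :: "'a set \<Rightarrow> 'a rel \<Rightarrow> 'a rel \<times> 'a rel" where
  "Fact S arr =
     ({(x, y). x \<in> S \<and> y \<in> S \<and> (\<forall>z\<in>S. (y, z) \<in> arr \<longrightarrow> (x, z) \<in> arr)},
      {(x, y). x \<in> S \<and> y \<in> S \<and> (\<forall>z\<in>S. (z, x) \<in> arr \<longrightarrow> (z, y) \<in> arr)})"

definition Mult :: "'a set \<Rightarrow> 'a rel \<Rightarrow> 'a rel \<Rightarrow> 'a rel" where
  "Mult S tw hk = {(x, z). x \<in> S \<and> z \<in> S \<and> (\<exists>y\<in>S. (x, y) \<in> tw \<and> (y, z) \<in> hk)}"

definition factorization_system :: "'a set \<Rightarrow> 'a rel \<Rightarrow> 'a rel \<Rightarrow> 'a rel \<Rightarrow> bool" where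
  "factorization_system S arr tw hk \<longleftrightarrow>
     arr \<subseteq> S \<times> S \<and> refl_on S arr \<and> Fact S arr = (tw, hk) \<and> Mult S tw hk = arr"

definition two_acyclic :: "'a set \<Rightarrow> 'a rel \<Rightarrow> 'a rel \<Rightarrow> bool" where
  "two_acyclic S tw hk \<longleftrightarrow>
     (\<forall>x\<in>S. \<forall>y\<in>S. ((x, y) \<in> tw \<and> (y, x) \<in> tw \<longrightarrow> x = y) \<and>
                   ((x, y) \<in> hk \<and> (y, x) \<in> hk \<longrightarrow> x = y) \<and>
                   ((x, y) \<in> tw \<and> (y, x) \<in> hk \<longrightarrow> x = y))"

text \<open>
  Both \<open>x \<twoheadrightarrow> y\<close> and \<open>x \<hookrightarrow> y\<close> are read as ``\<open>x\<close> is greater than or equal to \<open>y\<close>''.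
\<close>

definition minimal_in :: "'a rel \<Rightarrow> 'a set \<Rightarrow> 'a \<Rightarrow> bool" where
  "minimal_in r A x \<longleftrightarrow> x \<in> A \<and> \<not> (\<exists>x'\<in>A - {x}. (x, x') \<in> r)"

definition maximal_in :: "'a rel \<Rightarrow> 'a set \<Rightarrow> 'a \<Rightarrow> bool" where
  "maximal_in r A x \<longleftrightarrow> x \<in> A \<and> \<not> (\<exists>x'\<in>A - {x}. (x', x) \<in> r)"

definition between :: "'a set \<Rightarrow> 'a rel \<Rightarrow> 'a rel \<Rightarrow> 'a \<Rightarrow> 'a \<Rightarrow> 'a set" where
  "between S tw hk x z = {y \<in> S. (x, y) \<in> tw \<and> (y, z) \<in> hk}"

definition image_condition :: "'a set \<Rightarrow> 'a rel \<Rightarrow> 'a rel \<Rightarrow> 'a rel \<Rightarrow> bool" where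
  "image_condition S arr tw hk \<longleftrightarrow>
     (\<forall>x\<in>S. \<forall>z\<in>S. (x, z) \<in> arr \<longrightarrow>
        (\<exists>y. minimal_in tw (between S tw hk x z) y) \<and>
        (\<exists>y. maximal_in hk (between S tw hk x z) y))"

definition T_set :: "'a set \<Rightarrow> 'a rel \<Rightarrow> 'a \<Rightarrow> 'a set" where
  "T_set S tw y = {x' \<in> S. (y, x') \<in> tw}"

definition T_star :: "'a set \<Rightarrow> 'a rel \<Rightarrow> 'a \<Rightarrow> 'a set" where
  "T_star S tw y = T_set S tw y - {y}"

definition F_set :: "'a set \<Rightarrow> 'a rel \<Rightarrow> 'a \<Rightarrow> 'a set" where
  "F_set S hk y = {x' \<in> S. (x', y) \<in> hk}"

definition T_pair :: "'a set \<Rightarrow> 'a rel \<Rightarrow> 'a rel \<Rightarrow> 'a \<Rightarrow> 'a set \<times> 'a set" where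
  "T_pair S arr tw x = (T_set S tw x, rperp S arr (T_set S tw x))"

definition T_star_pair :: "'a set \<Rightarrow> 'a rel \<Rightarrow> 'a rel \<Rightarrow> 'a \<Rightarrow> 'a set \<times> 'a set" where
  "T_star_pair S arr tw x = (T_star S tw x, rperp S arr (T_star S tw x))"

definition leadsto :: "'a set \<Rightarrow> 'a rel \<Rightarrow> 'a rel \<Rightarrow> 'a rel" where
  "leadsto S tw hk =
     {(x, y). x \<in> S \<and> y \<in> S \<and>
        (minimal_in tw (F_set S hk y) x \<or> maximal_in hk (T_set S tw y) x)}"

definition downsets :: "'a set \<Rightarrow> 'a rel \<Rightarrow> 'a set gorder" where
  "downsets S r = \<lparr>carrier = {D. D \<subseteq> S \<and> (\<forall>x y. x \<in> D \<longrightarrow> (x, y) \<in> r \<longrightarrow> y \<in> D)},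
                   eq = (=), le = (\<subseteq>)\<rparr>"

definition contracted_set :: "'a set \<Rightarrow> 'a rel \<Rightarrow> 'a rel \<Rightarrow> ('a set \<times> 'a set) rel \<Rightarrow> 'a set" where
  "contracted_set S arr tw \<Theta> =
     {x \<in> S. contracts (Pairs S arr) \<Theta> (T_star_pair S arr tw x) (T_pair S arr tw x)}"

definition downset_congruence :: "'a set \<Rightarrow> 'a rel \<Rightarrow> 'a rel \<Rightarrow> 'a set \<Rightarrow> ('a set \<times> 'a set) rel" where
  "downset_congruence S arr tw D =
     (THE \<Theta>. \<Theta> \<in> carrier (Con_cc (Pairs S arr)) \<and> contracted_set S arr tw \<Theta> = D)"

lemma Pairs_carrier_iff:
  "p \<in> carrier (Pairs S arr) \<longleftrightarrow>
     fst p \<subseteq> S \<and> lperp S arr (rperp S arr (fst p)) = fst p \<and> snd p = rperp S arr (fst p)"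
  by (cases p) (auto simp: Pairs_def rperp_def)

lemma Pairs_simps [simp]:
  "p \<sqsubseteq>\<^bsub>Pairs S arr\<^esub> q \<longleftrightarrow> fst p \<subseteq> fst q"
  "p .=\<^bsub>Pairs S arr\<^esub> q \<longleftrightarrow> p = q"
  by (auto simp: Pairs_def)

lemma Con_cc_simps [simp]:
  "\<Theta> \<in> carrier (Con_cc L) \<longleftrightarrow> complete_congruence L \<Theta> \<and> cover_determined L \<Theta>"
  "\<Theta> \<sqsubseteq>\<^bsub>Con_cc L\<^esub> \<Psi> \<longleftrightarrow> \<Theta> \<subseteq> \<Psi>"
  "\<Theta> .=\<^bsub>Con_cc L\<^esub> \<Psi> \<longleftrightarrow> \<Theta> = \<Psi>"
  by (auto simp: Con_cc_def)

lemma partial_order_Pairs: "partial_order (Pairs S arr)"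
proof (unfold_locales, goal_cases)
  case (5 x y)
  then show ?case by (simp add: prod_eq_iff Pairs_carrier_iff)
qed (auto simp: Pairs_def)

theorem complete_lattice_Pairs: "complete_lattice (Pairs S arr)"
proof (rule partial_order.complete_lattice_criterion1[OF partial_order_Pairs])
  have "lperp S arr (rperp S arr S) = S"
    by (auto simp: rperp_def lperp_def)
  then have "greatest (Pairs S arr) (S, rperp S arr S) (carrier (Pairs S arr))"
    by (simp add: greatest_def Pairs_carrier_iff)
  then show "\<exists>g. greatest (Pairs S arr) g (carrier (Pairs S arr))" ..
next
  fix A assume A: "A \<subseteq> carrier (Pairs S arr)" "A \<noteq> {}"
  define X where "X = \<Inter> (fst ` A)"
  have closed: "lperp S arr (rperp S arr (fst p)) = fst p" "fst p \<subseteq> S" if "p \<in> A" for p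
    using subsetD[OF A(1) that] by (simp_all add: Pairs_carrier_iff)
  have XS: "X \<subseteq> S" using A(2) closed(2) unfolding X_def by blast
  have Xc: "lperp S arr (rperp S arr X) = X"
  proof
    show "X \<subseteq> lperp S arr (rperp S arr X)" using XS by (auto simp: lperp_def rperp_def)
    have "lperp S arr (rperp S arr X) \<subseteq> lperp S arr (rperp S arr (fst p))" if "p \<in> A" for p
      using that unfolding lperp_def rperp_def X_def by blast
    then show "lperp S arr (rperp S arr X) \<subseteq> X" using closed(1) unfolding X_def by blast
  qed
  have "(X, rperp S arr X) \<in> carrier (Pairs S arr)"
    using XS Xc by (simp add: Pairs_carrier_iff)
  then have "(X, rperp S arr X) \<in> Lower (Pairs S arr) A"
    unfolding Lower_def by (auto simp: X_def)
  moreover have "fst q \<subseteq> X" if q: "q \<in> Lower (Pairs S arr) A" for q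
    unfolding X_def
  proof (rule INF_greatest)
    fix p assume "p \<in> A"
    then have "p \<in> A \<inter> carrier (Pairs S arr)" using subsetD[OF A(1)] by simp
    then show "fst q \<subseteq> fst p" using q unfolding Lower_def by (cases p) auto
  qed
  ultimately have "greatest (Pairs S arr) (X, rperp S arr X) (Lower (Pairs S arr) A)"
    by (simp add: greatest_def Lower_closed)
  then show "\<exists>i. greatest (Pairs S arr) i (Lower (Pairs S arr) A)" ..
qed

lemma partial_order_Con_cc: "partial_order (Con_cc L)"
  by unfold_locales (auto simp: Con_cc_def)

theorem complete_lattice_Con_cc:
  assumes "complete_lattice L"
  shows "complete_lattice (Con_cc L)"
proof (rule partial_order.complete_lattice_criterion1[OF partial_order_Con_cc])
  interpret L: complete_lattice L by fact
  let ?U = "carrier L \<times> carrier L"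
  have "?U \<in> carrier (Con_cc L)"
  proof -
    have "\<Squnion>\<^bsub>L\<^esub> (f ` K) \<in> carrier L" "\<Sqinter>\<^bsub>L\<^esub> (f ` K) \<in> carrier L"
      if "f ` K \<subseteq> carrier L" for f :: "'a \<times> 'a \<Rightarrow> 'a" and K
      using that by auto
    moreover have "fst ` K \<subseteq> carrier L" "snd ` K \<subseteq> carrier L" if "K \<subseteq> ?U" for K
      using that by auto
    ultimately show ?thesis
      by (simp add: complete_congruence_def lattice_congruence_def cover_determined_def
          equiv_def refl_on_def sym_def trans_def)
  qed
  moreover have "\<Theta> \<subseteq> ?U" if "\<Theta> \<in> carrier (Con_cc L)" for \<Theta>
    using that by (simp add: complete_congruence_def lattice_congruence_def equiv_def)
  ultimately have "greatest (Con_cc L) ?U (carrier (Con_cc L))"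
    unfolding greatest_def by (auto simp del: Con_cc_simps(1))
  then show "\<exists>g. greatest (Con_cc L) g (carrier (Con_cc L))" ..
next
  fix A assume A: "A \<subseteq> carrier (Con_cc L)" "A \<noteq> {}"
  then have mem: "complete_congruence L \<Theta>" "cover_determined L \<Theta>" "lattice_congruence L \<Theta>"
    "equiv (carrier L) \<Theta>" if "\<Theta> \<in> A" for \<Theta>
    using A(1) that by (auto simp: complete_congruence_def lattice_congruence_def subset_iff)
  have "equiv (carrier L) (\<Inter>A)"
  proof (rule equivI)
    show "\<Inter>A \<subseteq> carrier L \<times> carrier L" using A(2) mem(4) unfolding equiv_def by blast
    show "refl_on (carrier L) (\<Inter>A)" using mem(4) by (auto simp: equiv_def refl_on_def)
    show "sym (\<Inter>A)" using mem(4) by (auto simp: equiv_def sym_def)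
    show "trans (\<Inter>A)" using mem(4) unfolding equiv_def trans_def by blast
  qed
  then have "lattice_congruence L (\<Inter>A)"
    using mem(3) unfolding lattice_congruence_def by blast
  then have "complete_congruence L (\<Inter>A)"
    using mem(1) unfolding complete_congruence_def by (simp add: le_Inf_iff)
  moreover have "cover_determined L (\<Inter>A)"
    using mem(2) unfolding cover_determined_def by blast
  ultimately have "\<Inter>A \<in> carrier (Con_cc L)" by simp
  then have "greatest (Con_cc L) (\<Inter>A) (Lower (Con_cc L) A)"
    using A(1) unfolding greatest_def Lower_def Con_cc_simps(2) by blast
  then show "\<exists>i. greatest (Con_cc L) i (Lower (Con_cc L) A)" ..
qed

lemma lower_cover_T_pair:
  assumes fs: "factorization_system S arr tw hk" and ac: "two_acyclic S tw hk" and x: "x \<in> S"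
  shows "lower_cover (Pairs S arr) (T_pair S arr tw x) = T_star_pair S arr tw x"
    and "covered_by (Pairs S arr) (T_star_pair S arr tw x) (T_pair S arr tw x)"
proof -
  let ?L = "Pairs S arr" and ?T = "T_set S tw x" and ?T' = "T_star S tw x"
  from fs have arr: "arr \<subseteq> S \<times> S" and refl: "\<And>y. y \<in> S \<Longrightarrow> (y, y) \<in> arr"
    and tw: "tw = {(x, y). x \<in> S \<and> y \<in> S \<and> (\<forall>z\<in>S. (y, z) \<in> arr \<longrightarrow> (x, z) \<in> arr)}"
    and arr_eq: "arr = Mult S tw hk"
    by (simp_all add: factorization_system_def Fact_def refl_on_def)
  have mult: "\<exists>y\<in>S. (a, y) \<in> tw \<and> (y, b) \<in> hk" if "(a, b) \<in> arr" for a b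
    using that unfolding arr_eq by (simp add: Mult_def)
  have T: "rperp S arr ?T = {z \<in> S. (x, z) \<notin> arr}"
    using x by (auto simp: rperp_def T_set_def tw)
  have Tc: "lperp S arr (rperp S arr ?T) = ?T"
    unfolding T using x by (auto simp: lperp_def T_set_def tw)
  have noarr: "(y, x) \<notin> arr" if y: "y \<in> ?T'" for y
  proof
    assume "(y, x) \<in> arr"
    then obtain w where w: "w \<in> S" "(y, w) \<in> tw" "(w, x) \<in> hk" using mult by blast
    have xy: "(x, y) \<in> tw" "y \<in> S" "y \<noteq> x" using y by (auto simp: T_star_def T_set_def)
    then have "(x, w) \<in> tw" using w tw by auto
    then have "w = x" using ac w x by (auto simp: two_acyclic_def)
    then show False using ac w xy x by (auto simp: two_acyclic_def)
  qed
  have T'c: "lperp S arr (rperp S arr ?T') = ?T'"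
  proof
    show "?T' \<subseteq> lperp S arr (rperp S arr ?T')"
      by (auto simp: lperp_def rperp_def T_star_def T_set_def)
    have "lperp S arr (rperp S arr ?T') \<subseteq> lperp S arr (rperp S arr ?T)"
      by (auto simp: lperp_def rperp_def T_star_def)
    then have "lperp S arr (rperp S arr ?T') \<subseteq> ?T"
      unfolding Tc .
    moreover have "x \<in> rperp S arr ?T'" using x noarr by (auto simp: rperp_def)
    then have "x \<notin> lperp S arr (rperp S arr ?T')" using refl x by (auto simp: lperp_def)
    ultimately show "lperp S arr (rperp S arr ?T') \<subseteq> ?T'" by (auto simp: T_star_def)
  qed
  have xT: "x \<in> ?T" using x by (auto simp: T_set_def tw)
  have carr: "T_pair S arr tw x \<in> carrier ?L" "T_star_pair S arr tw x \<in> carrier ?L"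
    using Tc T'c by (auto simp: Pairs_carrier_iff T_pair_def T_star_pair_def T_set_def T_star_def)
  have lt: "T_star_pair S arr tw x \<sqsubset>\<^bsub>?L\<^esub> T_pair S arr tw x"
    using xT by (auto simp: lless_def T_pair_def T_star_pair_def T_star_def)
  have below: "p \<sqsubseteq>\<^bsub>?L\<^esub> T_star_pair S arr tw x"
    if p: "p \<in> carrier ?L" and le: "p \<sqsubset>\<^bsub>?L\<^esub> T_pair S arr tw x" for p
  proof -
    have sub: "fst p \<subseteq> ?T" using le by (auto simp: lless_def T_pair_def)
    have "x \<notin> fst p"
    proof
      assume xp: "x \<in> fst p"
      then have "?T \<subseteq> lperp S arr (rperp S arr (fst p))"
        unfolding tw T_set_def lperp_def rperp_def by blast
      then have "?T \<subseteq> fst p" using p by (simp add: Pairs_carrier_iff)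
      then have "p = T_pair S arr tw x"
        using sub p carr(1) by (auto simp: prod_eq_iff T_pair_def Pairs_carrier_iff)
      then show False using le by (auto simp: lless_def)
    qed
    then show ?thesis using sub by (auto simp: T_star_pair_def T_star_def)
  qed
  interpret L: partial_order ?L by (rule partial_order_Pairs)
  show cov: "covered_by ?L (T_star_pair S arr tw x) (T_pair S arr tw x)"
    unfolding covered_by_def using carr lt below
    by (metis L.lless_eq L.le_antisym)
  show "lower_cover ?L (T_pair S arr tw x) = T_star_pair S arr tw x"
    unfolding lower_cover_def
  proof (rule the_equality[where P = "\<lambda>a. covered_by ?L a (T_pair S arr tw x)", OF cov])
    fix a assume "covered_by ?L a (T_pair S arr tw x)"
    then show "a = T_star_pair S arr tw x"
      unfolding covered_by_def using carr lt below by (metis L.lless_eq)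
  qed
qed

end

theory Submission
  imports Defs
begin

text \<open>
  For a downset \<open>D\<close> of \<open>\<leadsto>\<close>, identify two maximal orthogonal pairs when their first components
  agree outside \<open>D\<close>. The image condition together with the downset property of \<open>D\<close> makes this the
  same as agreement of the second components outside \<open>D\<close>; as meets intersect first components and
  joins intersect second components, the identification is a complete congruence. Conversely,
  every congruence that identifies \<open>p\<close> and \<open>q\<close> contracts all \<open>w\<close> in \<open>fst q \<inter> snd p\<close>, such \<open>w\<close>
  label the covers between \<open>p\<close> and \<open>q\<close>, and so a cover-determined congruence can be recovered
  from the set of \<open>w\<close> that it contracts.
\<close>

section \<open>Order, meets and joins of \<open>Pairs\<close> in terms of components\<close>

text \<open>Intersections of sets closed under the Galois connection of \<open>rperp\<close> and
  \<open>lperp\<close> are closed. The factor \<open>S\<close> takes care of empty \<open>A\<close>,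
  whose meet is the top.\<close>

lemma fst_inf_Pairs:
  assumes "A \<subseteq> carrier (Pairs S arr)"
  shows "fst (\<Sqinter>\<^bsub>Pairs S arr\<^esub> A) = S \<inter> \<Inter> (fst ` A)"
proof -
  let ?L = "Pairs S arr" and ?X = "S \<inter> \<Inter> (fst ` A)"
  interpret L: complete_lattice ?L by (rule complete_lattice_Pairs)
  have closed: "lperp S arr (rperp S arr (fst p)) = fst p" if "p \<in> A" for p
    using subsetD[OF assms that] by (simp add: Pairs_carrier_iff)
  have "lperp S arr (rperp S arr ?X) = ?X"
  proof
    show "?X \<subseteq> lperp S arr (rperp S arr ?X)" by (auto simp: lperp_def rperp_def)
    have "lperp S arr (rperp S arr ?X) \<subseteq> lperp S arr (rperp S arr (fst p))" if "p \<in> A" for p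
      using that unfolding lperp_def rperp_def by blast
    moreover have "lperp S arr (rperp S arr ?X) \<subseteq> S" by (auto simp: lperp_def)
    ultimately show "lperp S arr (rperp S arr ?X) \<subseteq> ?X" using closed by blast
  qed
  then have c: "(?X, rperp S arr ?X) \<in> carrier ?L" by (simp add: Pairs_carrier_iff)
  have i: "\<Sqinter>\<^bsub>?L\<^esub> A \<in> carrier ?L" using assms by simp
  have "(?X, rperp S arr ?X) \<sqsubseteq>\<^bsub>?L\<^esub> \<Sqinter>\<^bsub>?L\<^esub> A"
    by (rule L.inf_greatest) (use assms c in auto)
  moreover have "fst (\<Sqinter>\<^bsub>?L\<^esub> A) \<subseteq> fst p" if "p \<in> A" for p
    using L.inf_lower[OF assms that] by simp
  moreover have "fst (\<Sqinter>\<^bsub>?L\<^esub> A) \<subseteq> S" using i by (simp add: Pairs_carrier_iff)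
  ultimately show ?thesis by auto
qed

lemma Pairs_le_iff_snd:
  assumes "p \<in> carrier (Pairs S arr)" "q \<in> carrier (Pairs S arr)"
  shows "fst p \<subseteq> fst q \<longleftrightarrow> snd q \<subseteq> snd p"
proof
  assume "fst p \<subseteq> fst q"
  then show "snd q \<subseteq> snd p" using assms by (auto simp: Pairs_carrier_iff rperp_def)
next
  assume "snd q \<subseteq> snd p"
  then have "lperp S arr (snd p) \<subseteq> lperp S arr (snd q)" by (auto simp: lperp_def)
  then show "fst p \<subseteq> fst q" using assms by (simp add: Pairs_carrier_iff)
qed

text \<open>The order is reversed on second components, so joins intersect them. First components of
  joins have no such formula; membership in them is later shown by contradiction through
  \<open>not_fst\<close>.\<close>

lemma snd_sup_Pairs:
  assumes "A \<subseteq> carrier (Pairs S arr)"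
  shows "snd (\<Squnion>\<^bsub>Pairs S arr\<^esub> A) = S \<inter> \<Inter> (snd ` A)"
proof -
  let ?L = "Pairs S arr" and ?Y = "S \<inter> \<Inter> (snd ` A)"
  interpret L: complete_lattice ?L by (rule complete_lattice_Pairs)
  have mem: "p \<in> carrier ?L" if "p \<in> A" for p using assms that by auto
  have closed: "rperp S arr (lperp S arr (snd p)) = snd p" if "p \<in> A" for p
    using mem[OF that] by (simp add: Pairs_carrier_iff)
  have Yc: "rperp S arr (lperp S arr ?Y) = ?Y"
  proof
    show "?Y \<subseteq> rperp S arr (lperp S arr ?Y)" by (auto simp: lperp_def rperp_def)
    have "rperp S arr (lperp S arr ?Y) \<subseteq> rperp S arr (lperp S arr (snd p))" if "p \<in> A" for p
      using that unfolding lperp_def rperp_def by blast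
    moreover have "rperp S arr (lperp S arr ?Y) \<subseteq> S" by (auto simp: rperp_def)
    ultimately show "rperp S arr (lperp S arr ?Y) \<subseteq> ?Y" using closed by blast
  qed
  then have c: "(lperp S arr ?Y, ?Y) \<in> carrier ?L"
    by (simp add: Pairs_carrier_iff) (auto simp: lperp_def)
  have s: "\<Squnion>\<^bsub>?L\<^esub> A \<in> carrier ?L" using assms by simp
  have "\<Squnion>\<^bsub>?L\<^esub> A \<sqsubseteq>\<^bsub>?L\<^esub> (lperp S arr ?Y, ?Y)"
    by (rule L.sup_least) (use assms c Pairs_le_iff_snd[OF mem c] in auto)
  then have "?Y \<subseteq> snd (\<Squnion>\<^bsub>?L\<^esub> A)"
    using Pairs_le_iff_snd[OF s c] by simp
  moreover have "snd (\<Squnion>\<^bsub>?L\<^esub> A) \<subseteq> snd p" if "p \<in> A" for p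
    using L.sup_upper[OF assms that] Pairs_le_iff_snd[OF mem[OF that] s] by simp
  moreover have "snd (\<Squnion>\<^bsub>?L\<^esub> A) \<subseteq> S" using s by (auto simp: Pairs_carrier_iff rperp_def)
  ultimately show ?thesis by auto
qed

lemma Pairs_eqI_fst:
  assumes "p \<in> carrier (Pairs S arr)" "q \<in> carrier (Pairs S arr)" "fst p = fst q"
  shows "p = q"
  using assms by (simp add: prod_eq_iff Pairs_carrier_iff)

lemma Pairs_eqI_snd:
  assumes "p \<in> carrier (Pairs S arr)" "q \<in> carrier (Pairs S arr)" "snd p = snd q"
  shows "p = q"
  using assms Pairs_le_iff_snd[of p S arr q] Pairs_le_iff_snd[of q S arr p]
  by (auto simp: prod_eq_iff)

context
  fixes S :: "'a set" and arr :: "'a rel"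
begin

interpretation L: complete_lattice "Pairs S arr" by (rule complete_lattice_Pairs)

lemma Pairs_join_closed:
  "p \<in> carrier (Pairs S arr) \<Longrightarrow> q \<in> carrier (Pairs S arr) \<Longrightarrow>
    p \<squnion>\<^bsub>Pairs S arr\<^esub> q \<in> carrier (Pairs S arr)"
  by simp

lemma Pairs_meet_closed:
  "p \<in> carrier (Pairs S arr) \<Longrightarrow> q \<in> carrier (Pairs S arr) \<Longrightarrow>
    p \<sqinter>\<^bsub>Pairs S arr\<^esub> q \<in> carrier (Pairs S arr)"
  by simp

lemma fst_meet_Pairs:
  assumes "p \<in> carrier (Pairs S arr)" "q \<in> carrier (Pairs S arr)"
  shows "fst (p \<sqinter>\<^bsub>Pairs S arr\<^esub> q) = fst p \<inter> fst q"
  using assms fst_inf_Pairs[of "{p, q}" S arr] by (auto simp: meet_def Pairs_carrier_iff)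

lemma snd_join_Pairs:
  assumes "p \<in> carrier (Pairs S arr)" "q \<in> carrier (Pairs S arr)"
  shows "snd (p \<squnion>\<^bsub>Pairs S arr\<^esub> q) = snd p \<inter> snd q"
  using assms snd_sup_Pairs[of "{p, q}" S arr]
  by (auto simp: join_def Pairs_carrier_iff rperp_def)

lemma fst_join_Pairs_upper:
  assumes "p \<in> carrier (Pairs S arr)" "q \<in> carrier (Pairs S arr)"
  shows "fst p \<subseteq> fst (p \<squnion>\<^bsub>Pairs S arr\<^esub> q)" "fst q \<subseteq> fst (p \<squnion>\<^bsub>Pairs S arr\<^esub> q)"
  using L.join_left[OF assms] L.join_right[OF assms] by simp_all

lemma fst_join_Pairs_least:
  assumes "p \<in> carrier (Pairs S arr)" "q \<in> carrier (Pairs S arr)" "r \<in> carrier (Pairs S arr)"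
    and "fst p \<subseteq> fst r" "fst q \<subseteq> fst r"
  shows "fst (p \<squnion>\<^bsub>Pairs S arr\<^esub> q) \<subseteq> fst r"
  using L.join_le[of p r q] assms by simp

end

section \<open>Calculus of the three relations and of orthogonal pairs\<close>

locale two_acyclic_factorization_system =
  fixes S :: "'a set" and arr tw hk :: "'a rel"
  assumes fs: "factorization_system S arr tw hk"
    and ac: "two_acyclic S tw hk"
begin

abbreviation L where "L \<equiv> Pairs S arr"
abbreviation T where "T \<equiv> T_pair S arr tw"
abbreviation Ts where "Ts \<equiv> T_star_pair S arr tw"

lemma arr_dom: "(x, y) \<in> arr \<Longrightarrow> x \<in> S \<and> y \<in> S"
  and arr_refl: "x \<in> S \<Longrightarrow> (x, x) \<in> arr"
  and tw_iff: "(x, y) \<in> tw \<longleftrightarrow> x \<in> S \<and> y \<in> S \<and> (\<forall>z\<in>S. (y, z) \<in> arr \<longrightarrow> (x, z) \<in> arr)"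
  and hk_iff: "(x, y) \<in> hk \<longleftrightarrow> x \<in> S \<and> y \<in> S \<and> (\<forall>z\<in>S. (z, x) \<in> arr \<longrightarrow> (z, y) \<in> arr)"
  using fs by (auto simp: factorization_system_def Fact_def refl_on_def)

lemma arr_factor: "(x, z) \<in> arr \<Longrightarrow> \<exists>y\<in>S. (x, y) \<in> tw \<and> (y, z) \<in> hk"
  using fs unfolding factorization_system_def Mult_def by blast

lemma tw_refl: "x \<in> S \<Longrightarrow> (x, x) \<in> tw"
  and hk_refl: "x \<in> S \<Longrightarrow> (x, x) \<in> hk"
  and tw_trans: "(x, y) \<in> tw \<Longrightarrow> (y, z) \<in> tw \<Longrightarrow> (x, z) \<in> tw"
  and hk_trans: "(x, y) \<in> hk \<Longrightarrow> (y, z) \<in> hk \<Longrightarrow> (x, z) \<in> hk"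
  and tw_arr: "(x, y) \<in> tw \<Longrightarrow> (x, y) \<in> arr"
  and hk_arr: "(x, y) \<in> hk \<Longrightarrow> (x, y) \<in> arr"
  and tw_arr_trans: "(x, y) \<in> tw \<Longrightarrow> (y, z) \<in> arr \<Longrightarrow> (x, z) \<in> arr"
  and arr_hk_trans: "(x, y) \<in> arr \<Longrightarrow> (y, z) \<in> hk \<Longrightarrow> (x, z) \<in> arr"
  using arr_dom arr_refl by (auto simp: tw_iff hk_iff)

lemma tw_antisym: "(x, y) \<in> tw \<Longrightarrow> (y, x) \<in> tw \<Longrightarrow> x = y"
  and hk_antisym: "(x, y) \<in> hk \<Longrightarrow> (y, x) \<in> hk \<Longrightarrow> x = y"
  and tw_hk_eq: "(x, y) \<in> tw \<Longrightarrow> (y, x) \<in> hk \<Longrightarrow> x = y"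
  using ac by (auto simp: two_acyclic_def tw_iff hk_iff)

text \<open>Factor the arrow through \<open>w\<close>. Then
  \<open>x \<twoheadrightarrow> w \<hookrightarrow> x\<close>, so \<open>w = x\<close> and
  \<open>x \<hookrightarrow> y \<hookrightarrow> x\<close>. This and its dual
  \<open>tw_arr_eq\<close> strengthen two-acyclicity: one step of the 2-cycle may be a mere
  arrow.\<close>

lemma arr_hk_eq: "(x, y) \<in> arr \<Longrightarrow> (y, x) \<in> hk \<Longrightarrow> x = y"
  by (metis arr_factor hk_antisym hk_trans tw_hk_eq)

lemma tw_arr_eq: "(x, y) \<in> tw \<Longrightarrow> (y, x) \<in> arr \<Longrightarrow> x = y"
  by (metis arr_factor tw_antisym tw_trans tw_hk_eq)

lemma Pairs_sub: "p \<in> carrier L \<Longrightarrow> fst p \<subseteq> S" "p \<in> carrier L \<Longrightarrow> snd p \<subseteq> S"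
  by (auto simp: Pairs_carrier_iff rperp_def)

lemma Pairs_orth: "p \<in> carrier L \<Longrightarrow> x \<in> fst p \<Longrightarrow> y \<in> snd p \<Longrightarrow> (x, y) \<notin> arr"
  by (auto simp: Pairs_carrier_iff rperp_def)

lemma Pairs_disjoint: "p \<in> carrier L \<Longrightarrow> x \<in> fst p \<Longrightarrow> x \<notin> snd p"
  using Pairs_orth Pairs_sub arr_refl by blast

lemma not_fst: "p \<in> carrier L \<Longrightarrow> x \<in> S \<Longrightarrow> x \<notin> fst p \<Longrightarrow> \<exists>y\<in>snd p. (x, y) \<in> arr"
  by (auto simp: Pairs_carrier_iff lperp_def)

lemma not_snd: "p \<in> carrier L \<Longrightarrow> y \<in> S \<Longrightarrow> y \<notin> snd p \<Longrightarrow> \<exists>x\<in>fst p. (x, y) \<in> arr"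
  by (auto simp: Pairs_carrier_iff rperp_def)

text \<open>An arrow from \<open>y\<close> into \<open>snd p\<close> would extend to one from
  \<open>x\<close>. With the dual \<open>snd_hk_closed\<close>, the middle of a factorization of an
  arrow from \<open>fst q\<close> to \<open>snd p\<close> lies in both sets; this is how all labels
  \<open>w\<close> below are found.\<close>

lemma fst_tw_closed: "p \<in> carrier L \<Longrightarrow> x \<in> fst p \<Longrightarrow> (x, y) \<in> tw \<Longrightarrow> y \<in> fst p"
  by (meson Pairs_orth not_fst tw_arr_trans tw_iff)

lemma snd_hk_closed: "p \<in> carrier L \<Longrightarrow> y \<in> snd p \<Longrightarrow> (x, y) \<in> hk \<Longrightarrow> x \<in> snd p"
  by (meson Pairs_orth not_snd arr_hk_trans hk_iff)

section \<open>The pairs \<open>T x\<close> and \<open>M y\<close>, and the complete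
  join-irreducibles\<close>

lemma lower_cover_T: "x \<in> S \<Longrightarrow> lower_cover L (T x) = Ts x"
  and T_star_covered: "x \<in> S \<Longrightarrow> covered_by L (Ts x) (T x)"
  using lower_cover_T_pair[OF fs ac] by auto

lemma T_closed: "x \<in> S \<Longrightarrow> T x \<in> carrier L"
  and T_star_closed: "x \<in> S \<Longrightarrow> Ts x \<in> carrier L"
  using T_star_covered by (auto simp: covered_by_def)

lemma fst_T: "fst (T x) = {y. (x, y) \<in> tw}"
  and fst_T_star: "fst (Ts x) = {y. (x, y) \<in> tw} - {x}"
  by (auto simp: T_pair_def T_star_pair_def T_star_def T_set_def tw_iff)

lemma snd_T: "x \<in> S \<Longrightarrow> snd (T x) = {y \<in> S. (x, y) \<notin> arr}"
  by (auto simp: T_pair_def rperp_def T_set_def tw_iff)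

lemma self_fst_T: "x \<in> S \<Longrightarrow> x \<in> fst (T x)"
  by (simp add: fst_T tw_refl)

lemma T_le: "p \<in> carrier L \<Longrightarrow> x \<in> fst p \<Longrightarrow> fst (T x) \<subseteq> fst p"
  using fst_tw_closed[of p x] by (auto simp: fst_T)

text \<open>The dual of \<open>T\<close>: for \<open>y\<close> in \<open>S\<close>,
  \<open>T y\<close> is the least pair with \<open>y\<close> in its first component, and
  \<open>M y\<close> is the greatest pair with \<open>y\<close> in its second component.\<close>

definition M :: "'a \<Rightarrow> 'a set \<times> 'a set" where
  "M y = (lperp S arr (F_set S hk y), F_set S hk y)"

lemma fst_M: "y \<in> S \<Longrightarrow> fst (M y) = {x \<in> S. (x, y) \<notin> arr}"
  by (auto simp: M_def lperp_def F_set_def hk_refl dest: arr_hk_trans)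

lemma snd_M: "snd (M y) = {x. (x, y) \<in> hk}"
  by (auto simp: M_def F_set_def hk_iff)

lemma M_closed:
  assumes "y \<in> S" shows "M y \<in> carrier L"
proof -
  have "rperp S arr (fst (M y)) = snd (M y)"
    unfolding fst_M[OF assms] snd_M using assms arr_dom by (auto simp: rperp_def hk_iff)
  then show ?thesis by (simp add: M_def Pairs_carrier_iff) (auto simp: lperp_def)
qed

lemma T_inj: "inj_on T S"
proof (rule inj_onI)
  fix x y assume "x \<in> S" "y \<in> S" "T x = T y"
  then have "(x, y) \<in> tw" "(y, x) \<in> tw"
    using self_fst_T[of x] self_fst_T[of y] by (metis fst_T mem_Collect_eq)+
  then show "x = y" by (rule tw_antisym)
qed

text \<open>Every pair \<open>j\<close> is the join of the \<open>T x\<close> with \<open>x\<close>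
  in \<open>fst j\<close>, so an irreducible one is among them. Conversely, if \<open>T x\<close> is
  the join of a set that omits it, then no member of the set has \<open>x\<close> in its first
  component; all members lie below \<open>Ts x\<close>, and so does their join.\<close>

lemma Ji_c_Pairs: "Ji_c L = T ` S"
proof (intro equalityI subsetI)
  interpret L: complete_lattice L by (rule complete_lattice_Pairs)
  {
    fix j assume j: "j \<in> Ji_c L"
    then have jc: "j \<in> carrier L" by (simp add: Ji_c_def)
    let ?A = "T ` fst j"
    have A: "?A \<subseteq> carrier L" using T_closed Pairs_sub(1)[OF jc] by auto
    have "snd (\<Squnion>\<^bsub>L\<^esub> ?A) = S \<inter> (\<Inter>x\<in>fst j. snd (T x))"
      by (simp add: snd_sup_Pairs[OF A])
    also have "\<dots> = {y \<in> S. \<forall>x\<in>fst j. (x, y) \<notin> arr}"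
      using Pairs_sub(1)[OF jc] snd_T by blast
    also have "\<dots> = snd j" using jc by (simp add: Pairs_carrier_iff rperp_def)
    finally have "j = \<Squnion>\<^bsub>L\<^esub> ?A"
      using jc A by (intro Pairs_eqI_snd[of j S arr]) auto
    then have "j \<in> ?A" using j A unfolding Ji_c_def by blast
    then show "j \<in> T ` S" using Pairs_sub(1)[OF jc] by auto
  next
    fix j assume "j \<in> T ` S"
    then obtain x where x: "x \<in> S" "j = T x" by auto
    have "T x \<in> A" if A: "A \<subseteq> carrier L" and eq: "T x = \<Squnion>\<^bsub>L\<^esub> A" for A
    proof (rule ccontr)
      assume no: "T x \<notin> A"
      have "fst p \<subseteq> fst (Ts x)" if p: "p \<in> A" for p
      proof -
        have pc: "p \<in> carrier L" using A p by auto
        have le: "fst p \<subseteq> fst (T x)" using L.sup_upper[OF A p] eq by simp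
        have "x \<notin> fst p"
        proof
          assume "x \<in> fst p"
          then have "p = T x"
            using T_le[OF pc] le by (intro Pairs_eqI_fst[OF pc T_closed[OF x(1)]]) auto
          then show False using p no by simp
        qed
        then show ?thesis using le by (auto simp: fst_T fst_T_star)
      qed
      then have "\<Squnion>\<^bsub>L\<^esub> A \<sqsubseteq>\<^bsub>L\<^esub> Ts x" by (intro L.sup_least A T_star_closed x) simp
      then show False
        using eq self_fst_T[OF x(1)] by (auto simp: fst_T_star)
    qed
    then show "j \<in> Ji_c L" using x T_closed by (auto simp: Ji_c_def)
  }
qed

section \<open>Covers and their labels\<close>

text \<open>Every \<open>w\<close> in \<open>snd p\<close> labels a cover between \<open>p\<close>
  and \<open>p \<squnion> T w\<close>. The cover tests membership of \<open>w\<close>: the upper end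
  has \<open>w\<close> in its first component, while meeting with \<open>M w\<close> removes
  precisely the elements with an arrow to \<open>w\<close>.\<close>

lemma labelled_cover:
  assumes p: "p \<in> carrier L" and w: "w \<in> snd p"
  shows "covered_by L ((p \<squnion>\<^bsub>L\<^esub> T w) \<sqinter>\<^bsub>L\<^esub> M w) (p \<squnion>\<^bsub>L\<^esub> T w)"
    and "fst p \<subseteq> fst ((p \<squnion>\<^bsub>L\<^esub> T w) \<sqinter>\<^bsub>L\<^esub> M w)"
    and "fst (Ts w) \<subseteq> fst ((p \<squnion>\<^bsub>L\<^esub> T w) \<sqinter>\<^bsub>L\<^esub> M w)"
    and "w \<notin> fst ((p \<squnion>\<^bsub>L\<^esub> T w) \<sqinter>\<^bsub>L\<^esub> M w)"
    and "w \<in> fst (p \<squnion>\<^bsub>L\<^esub> T w)"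
proof -
  define a where "a = p \<squnion>\<^bsub>L\<^esub> T w"
  define b where "b = a \<sqinter>\<^bsub>L\<^esub> M w"
  have wS: "w \<in> S" using w Pairs_sub(2)[OF p] by auto
  note Tc = T_closed[OF wS] and Mc = M_closed[OF wS]
  have ac: "a \<in> carrier L" unfolding a_def by (rule Pairs_join_closed[OF p Tc])
  have bc: "b \<in> carrier L" unfolding b_def by (rule Pairs_meet_closed[OF ac Mc])
  have fb: "fst b = {z \<in> fst a. (z, w) \<notin> arr}"
    unfolding b_def using Pairs_sub(1)[OF ac] by (auto simp: fst_meet_Pairs[OF ac Mc] fst_M[OF wS])
  have sa: "snd a = {y \<in> snd p. (w, y) \<notin> arr}"
    unfolding a_def using Pairs_sub(2)[OF p] by (auto simp: snd_join_Pairs[OF p Tc] snd_T[OF wS])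
  have pa: "fst p \<subseteq> fst a" and Ta: "fst (T w) \<subseteq> fst a"
    unfolding a_def by (rule fst_join_Pairs_upper[OF p Tc])+
  show wa: "w \<in> fst (p \<squnion>\<^bsub>L\<^esub> T w)" using self_fst_T[OF wS] Ta by (auto simp: a_def)
  show "w \<notin> fst ((p \<squnion>\<^bsub>L\<^esub> T w) \<sqinter>\<^bsub>L\<^esub> M w)"
    using fb arr_refl[OF wS] by (auto simp: a_def b_def)
  show pb: "fst p \<subseteq> fst ((p \<squnion>\<^bsub>L\<^esub> T w) \<sqinter>\<^bsub>L\<^esub> M w)"
    using fb pa Pairs_orth[OF p _ w] by (auto simp: a_def b_def)
  show "fst (Ts w) \<subseteq> fst ((p \<squnion>\<^bsub>L\<^esub> T w) \<sqinter>\<^bsub>L\<^esub> M w)"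
    using fb Ta by (auto simp: a_def b_def fst_T fst_T_star dest: tw_arr_eq)
  \<comment> \<open>Anything in the interval strictly above \<open>b\<close> contains some
    \<open>d\<close> with an arrow to \<open>w\<close>. The middle \<open>v\<close> of its
    factorization lies in \<open>fst c\<close> and in \<open>snd p\<close>, so only an arrow from
    \<open>w\<close> can keep it out of \<open>snd a\<close>; then \<open>v = w\<close>, and
    \<open>c\<close> lies above both \<open>p\<close> and \<open>T w\<close>.\<close>
  have up: "fst a \<subseteq> fst c"
    if c: "c \<in> carrier L" and bl: "b \<sqsubset>\<^bsub>L\<^esub> c" and ca: "fst c \<subseteq> fst a" for c
  proof -
    have bsub: "fst b \<subseteq> fst c" and ne: "b \<noteq> c" using bl by (auto simp: lless_def)
    then obtain d where d: "d \<in> fst c" "d \<notin> fst b" using Pairs_eqI_fst[OF bc c] by blast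
    then have "(d, w) \<in> arr" using ca fb by auto
    then obtain v where v: "(d, v) \<in> tw" "(v, w) \<in> hk" using arr_factor by blast
    then have vc: "v \<in> fst c" using fst_tw_closed[OF c d(1)] by simp
    have "v \<in> snd p" using snd_hk_closed[OF p w v(2)] .
    moreover have "v \<notin> snd a" using vc ca Pairs_disjoint[OF ac] by auto
    ultimately have "(w, v) \<in> arr" by (simp add: sa)
    then have "w \<in> fst c" using arr_hk_eq v(2) vc by blast
    then have "fst (T w) \<subseteq> fst c" by (rule T_le[OF c])
    moreover have "fst p \<subseteq> fst c" using pb bsub by (auto simp: a_def b_def)
    ultimately show ?thesis
      unfolding a_def by (intro fst_join_Pairs_least[OF p Tc c])
  qed
  have "fst b \<subseteq> fst a" "b \<noteq> a" using fb wa arr_refl[OF wS] unfolding a_def[symmetric] by auto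
  then have "b \<sqsubset>\<^bsub>L\<^esub> a" by (simp add: lless_def)
  moreover have "\<not> (b \<sqsubset>\<^bsub>L\<^esub> c \<and> c \<sqsubset>\<^bsub>L\<^esub> a)" if "c \<in> carrier L" for c
    using up[OF that] Pairs_eqI_fst[OF that ac] by (auto simp: lless_def)
  ultimately have "covered_by L b a"
    unfolding covered_by_def using ac bc by blast
  then show "covered_by L ((p \<squnion>\<^bsub>L\<^esub> T w) \<sqinter>\<^bsub>L\<^esub> M w) (p \<squnion>\<^bsub>L\<^esub> T w)"
    by (simp add: a_def b_def)
qed

text \<open>Factor an arrow from \<open>fst a - fst b\<close> to \<open>snd b\<close> and take its
  middle \<open>w\<close>. The labelled cover of \<open>w\<close> over \<open>b\<close> lies in the
  interval from \<open>b\<close> to \<open>a\<close>, hence is the given cover. The two join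
  equations let joining with \<open>b\<close> carry the contraction of \<open>Ts w\<close>,
  \<open>T w\<close> over to this cover.\<close>

lemma cover_label:
  assumes cov: "covered_by L b a"
  obtains w where "w \<in> fst a" "w \<in> snd b" "b \<squnion>\<^bsub>L\<^esub> T w = a" "b \<squnion>\<^bsub>L\<^esub> Ts w = b"
proof -
  have bc: "b \<in> carrier L" and ac: "a \<in> carrier L" and ba: "fst b \<subseteq> fst a" "b \<noteq> a"
    and between: "\<And>c. c \<in> carrier L \<Longrightarrow> b \<sqsubset>\<^bsub>L\<^esub> c \<Longrightarrow> \<not> c \<sqsubset>\<^bsub>L\<^esub> a"
    using cov by (auto simp: covered_by_def lless_def)
  obtain d where d: "d \<in> fst a" "d \<notin> fst b" using ba Pairs_eqI_fst[OF bc ac] by blast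
  then obtain y where y: "y \<in> snd b" "(d, y) \<in> arr"
    using not_fst[OF bc, of d] Pairs_sub(1)[OF ac] by auto
  then obtain w where w: "(d, w) \<in> tw" "(w, y) \<in> hk" using arr_factor by blast
  have wa: "w \<in> fst a" using fst_tw_closed[OF ac d(1) w(1)] .
  have wb: "w \<in> snd b" using snd_hk_closed[OF bc y(1) w(2)] .
  have wS: "w \<in> S" using w by (auto simp: tw_iff)
  note Tc = T_closed[OF wS] and Tsc = T_star_closed[OF wS]
  let ?a = "b \<squnion>\<^bsub>L\<^esub> T w" and ?b = "(b \<squnion>\<^bsub>L\<^esub> T w) \<sqinter>\<^bsub>L\<^esub> M w"
  note lc = labelled_cover[OF bc wb]
  have a': "?a \<in> carrier L" by (rule Pairs_join_closed[OF bc Tc])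
  have b': "?b \<in> carrier L" by (rule Pairs_meet_closed[OF a' M_closed[OF wS]])
  have le: "fst ?a \<subseteq> fst a" by (rule fst_join_Pairs_least[OF bc Tc ac ba(1) T_le[OF ac wa]])
  have "b \<sqsubset>\<^bsub>L\<^esub> ?a"
    using fst_join_Pairs_upper(1)[OF bc Tc] lc(5) Pairs_disjoint[OF bc, of w] wb
    by (auto simp: lless_def)
  then have aa: "?a = a" using between[OF a'] le by (auto simp: lless_def)
  have "?b \<sqsubset>\<^bsub>L\<^esub> a" using lc(1) by (simp add: aa covered_by_def)
  then have bb: "?b = b" using between[OF b'] lc(2) by (metis lless_def Pairs_simps)
  have "fst (b \<squnion>\<^bsub>L\<^esub> Ts w) = fst b"
    using fst_join_Pairs_least[OF bc Tsc bc] lc(3) fst_join_Pairs_upper(1)[OF bc Tsc]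
    by (auto simp: bb)
  then have "b \<squnion>\<^bsub>L\<^esub> Ts w = b"
    by (rule Pairs_eqI_fst[OF Pairs_join_closed[OF bc Tsc] bc])
  then show ?thesis using that wa wb aa by blast
qed

section \<open>Labels contracted by a congruence\<close>

lemma contracted_set_iff: "x \<in> contracted_set S arr tw \<Theta> \<longleftrightarrow> x \<in> S \<and> (Ts x, T x) \<in> \<Theta>"
  using T_star_covered by (auto simp: contracted_set_def contracts_def)

context
  fixes \<Theta>
  assumes cong: "lattice_congruence L \<Theta>"
begin

lemma cong_closed: "(p, q) \<in> \<Theta> \<Longrightarrow> p \<in> carrier L \<and> q \<in> carrier L"
  and cong_refl: "p \<in> carrier L \<Longrightarrow> (p, p) \<in> \<Theta>"
  and cong_sym: "(p, q) \<in> \<Theta> \<Longrightarrow> (q, p) \<in> \<Theta>"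
  and cong_trans: "(p, q) \<in> \<Theta> \<Longrightarrow> (q, r) \<in> \<Theta> \<Longrightarrow> (p, r) \<in> \<Theta>"
  using cong by (auto simp: lattice_congruence_def equiv_def refl_on_def dest: symD transD)

lemma cong_join: "(p, p') \<in> \<Theta> \<Longrightarrow> (q, q') \<in> \<Theta> \<Longrightarrow> (p \<squnion>\<^bsub>L\<^esub> q, p' \<squnion>\<^bsub>L\<^esub> q') \<in> \<Theta>"
  and cong_meet: "(p, p') \<in> \<Theta> \<Longrightarrow> (q, q') \<in> \<Theta> \<Longrightarrow> (p \<sqinter>\<^bsub>L\<^esub> q, p' \<sqinter>\<^bsub>L\<^esub> q') \<in> \<Theta>"
  using cong unfolding lattice_congruence_def by blast+

text \<open>The lattice polynomial that meets with \<open>T w\<close> and then joins with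
  \<open>Ts w\<close> sends \<open>p\<close> to \<open>Ts w\<close>, because \<open>w\<close> is not
  in \<open>fst p\<close>, and \<open>q\<close> to \<open>T w\<close>, because \<open>T w\<close>
  lies below \<open>q\<close>.\<close>

lemma label_contracted:
  assumes pq: "(p, q) \<in> \<Theta>" and w: "w \<in> fst q" "w \<in> snd p"
  shows "w \<in> contracted_set S arr tw \<Theta>"
proof -
  have p: "p \<in> carrier L" and q: "q \<in> carrier L" using cong_closed[OF pq] by auto
  have wS: "w \<in> S" using w Pairs_sub[OF q] by auto
  note Tc = T_closed[OF wS] and Tsc = T_star_closed[OF wS]
  note mp = Pairs_meet_closed[OF Tc p] and mq = Pairs_meet_closed[OF Tc q]
  have "fst (T w \<sqinter>\<^bsub>L\<^esub> p) \<subseteq> fst (Ts w)"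
    using w(2) Pairs_disjoint[OF p, of w]
    by (auto simp: fst_meet_Pairs[OF Tc p] fst_T fst_T_star)
  then have 1: "(T w \<sqinter>\<^bsub>L\<^esub> p) \<squnion>\<^bsub>L\<^esub> Ts w = Ts w"
    using fst_join_Pairs_least[OF mp Tsc Tsc] fst_join_Pairs_upper(2)[OF mp Tsc]
    by (intro Pairs_eqI_fst[OF Pairs_join_closed[OF mp Tsc] Tsc]) auto
  have "fst (T w \<sqinter>\<^bsub>L\<^esub> q) = fst (T w)"
    using T_le[OF q w(1)] by (auto simp: fst_meet_Pairs[OF Tc q])
  then have "T w \<sqinter>\<^bsub>L\<^esub> q = T w" by (rule Pairs_eqI_fst[OF mq Tc])
  moreover have "T w \<squnion>\<^bsub>L\<^esub> Ts w = T w"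
    using fst_join_Pairs_least[OF Tc Tsc Tc] fst_join_Pairs_upper(1)[OF Tc Tsc]
    by (intro Pairs_eqI_fst[OF Pairs_join_closed[OF Tc Tsc] Tc]) (auto simp: fst_T fst_T_star)
  ultimately have 2: "(T w \<sqinter>\<^bsub>L\<^esub> q) \<squnion>\<^bsub>L\<^esub> Ts w = T w" by simp
  have "((T w \<sqinter>\<^bsub>L\<^esub> p) \<squnion>\<^bsub>L\<^esub> Ts w, (T w \<sqinter>\<^bsub>L\<^esub> q) \<squnion>\<^bsub>L\<^esub> Ts w) \<in> \<Theta>"
    by (intro cong_join cong_meet cong_refl Tc Tsc pq)
  then show ?thesis using wS by (simp add: contracted_set_iff 1 2)
qed

text \<open>Joining the contracted cover with \<open>M y\<close> absorbs its lower end. Both kinds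
  of \<open>leadsto\<close> start from such a pair.\<close>

lemma contracted_join_M:
  assumes x: "x \<in> contracted_set S arr tw \<Theta>" and y: "y \<in> S" and le: "fst (Ts x) \<subseteq> fst (M y)"
  shows "(M y, M y \<squnion>\<^bsub>L\<^esub> T x) \<in> \<Theta>"
proof -
  have xS: "x \<in> S" and xc: "(Ts x, T x) \<in> \<Theta>" using x by (auto simp: contracted_set_iff)
  note Mc = M_closed[OF y] and Tsc = T_star_closed[OF xS]
  have "M y \<squnion>\<^bsub>L\<^esub> Ts x = M y"
    using fst_join_Pairs_least[OF Mc Tsc Mc] le fst_join_Pairs_upper(1)[OF Mc Tsc]
    by (intro Pairs_eqI_fst[OF Pairs_join_closed[OF Mc Tsc] Mc]) auto
  then show ?thesis using cong_join[OF cong_refl[OF Mc] xc] by simp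
qed

text \<open>In each case a congruent pair is built with \<open>y\<close> in the second component on
  the left and in the first component on the right, and \<open>label_contracted\<close> applies.
  Minimality uses \<open>M y\<close> itself; maximality uses \<open>M x\<close>, cut down by
  \<open>T y\<close>.\<close>

lemma contracted_leadsto:
  assumes xy: "(x, y) \<in> leadsto S tw hk" and x: "x \<in> contracted_set S arr tw \<Theta>"
  shows "y \<in> contracted_set S arr tw \<Theta>"
proof -
  have xS: "x \<in> S" and yS: "y \<in> S" using xy by (auto simp: leadsto_def)
  note Tx = T_closed[OF xS] and Ty = T_closed[OF yS]
  from xy consider "minimal_in tw (F_set S hk y) x" | "maximal_in hk (T_set S tw y) x"
    by (auto simp: leadsto_def)
  then show ?thesis
  proof cases
    case 1
    then have hk: "(x, y) \<in> hk" and min: "\<And>v. (x, v) \<in> tw \<Longrightarrow> (v, y) \<in> hk \<Longrightarrow> v = x"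
      by (auto simp: minimal_in_def F_set_def hk_iff)
    note My = M_closed[OF yS]
    have "(z, y) \<notin> arr" if "(x, z) \<in> tw" "z \<noteq> x" for z
    proof
      assume "(z, y) \<in> arr"
      then obtain v where v: "(z, v) \<in> tw" "(v, y) \<in> hk" using arr_factor by blast
      then have "v = x" using min tw_trans that by blast
      then show False using v that tw_antisym by blast
    qed
    then have "fst (Ts x) \<subseteq> fst (M y)"
      by (auto simp: fst_T_star fst_M[OF yS] tw_iff)
    then have "(M y, M y \<squnion>\<^bsub>L\<^esub> T x) \<in> \<Theta>" by (rule contracted_join_M[OF x yS])
    \<comment> \<open>An obstruction \<open>z\<close> would satisfy
      \<open>y \<rightarrow> z \<hookrightarrow> y\<close>, hence \<open>z = y\<close>; but
      \<open>z\<close> receives no arrow from \<open>x\<close>, and \<open>y\<close> does.\<close>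
    moreover have "y \<in> fst (M y \<squnion>\<^bsub>L\<^esub> T x)"
    proof (rule ccontr)
      assume "y \<notin> fst (M y \<squnion>\<^bsub>L\<^esub> T x)"
      then obtain z where "z \<in> snd (M y \<squnion>\<^bsub>L\<^esub> T x)" "(y, z) \<in> arr"
        using not_fst[OF Pairs_join_closed[OF My Tx] yS] by blast
      then have "(z, y) \<in> hk" "(x, z) \<notin> arr" "(y, z) \<in> arr"
        by (auto simp: snd_join_Pairs[OF My Tx] snd_M snd_T[OF xS])
      then show False using arr_hk_eq hk hk_arr by blast
    qed
    moreover have "y \<in> snd (M y)" using yS by (simp add: snd_M hk_refl)
    ultimately show ?thesis by (rule label_contracted)
  next
    case 2
    then have tw: "(y, x) \<in> tw" and max: "\<And>v. (y, v) \<in> tw \<Longrightarrow> (v, x) \<in> hk \<Longrightarrow> v = x"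
      by (auto simp: maximal_in_def T_set_def tw_iff)
    note Mx = M_closed[OF xS]
    note j = Pairs_join_closed[OF Mx Tx]
    have "fst (Ts x) \<subseteq> fst (M x)"
      using tw_arr_eq[of x] tw_iff[of x] by (auto simp: fst_T_star fst_M[OF xS])
    then have "(M x, M x \<squnion>\<^bsub>L\<^esub> T x) \<in> \<Theta>" by (rule contracted_join_M[OF x xS])
    \<comment> \<open>Meeting with \<open>T y\<close> brings \<open>y\<close> into the second
      component on the left without losing it from the first component on the right.\<close>
    then have "(T y \<sqinter>\<^bsub>L\<^esub> M x, T y \<sqinter>\<^bsub>L\<^esub> (M x \<squnion>\<^bsub>L\<^esub> T x)) \<in> \<Theta>"
      by (intro cong_meet cong_refl Ty)
    moreover have "y \<in> fst (T y \<sqinter>\<^bsub>L\<^esub> (M x \<squnion>\<^bsub>L\<^esub> T x))"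
    proof -
      \<comment> \<open>Factoring the arrow from \<open>y\<close> to an obstruction \<open>z\<close>
        gives \<open>v\<close> with \<open>v \<hookrightarrow> z \<hookrightarrow> x\<close>.
        Maximality of \<open>x\<close> makes \<open>v = x\<close>, an arrow from \<open>x\<close> to
        \<open>z\<close> that was excluded.\<close>
      have "y \<in> fst (M x \<squnion>\<^bsub>L\<^esub> T x)"
      proof (rule ccontr)
        assume "y \<notin> fst (M x \<squnion>\<^bsub>L\<^esub> T x)"
        then obtain z where "z \<in> snd (M x \<squnion>\<^bsub>L\<^esub> T x)" "(y, z) \<in> arr"
          using not_fst[OF j yS] by blast
        then have z: "(z, x) \<in> hk" "(x, z) \<notin> arr" "(y, z) \<in> arr"
          by (auto simp: snd_join_Pairs[OF Mx Tx] snd_M snd_T[OF xS])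
        then obtain v where v: "(y, v) \<in> tw" "(v, z) \<in> hk" using arr_factor by blast
        then have "v = x" using max hk_trans z by blast
        then show False using v z hk_arr by blast
      qed
      then show ?thesis using self_fst_T[OF yS] by (simp add: fst_meet_Pairs[OF Ty j])
    qed
    moreover have "y \<in> snd (T y \<sqinter>\<^bsub>L\<^esub> M x)"
    proof (rule ccontr)
      assume "y \<notin> snd (T y \<sqinter>\<^bsub>L\<^esub> M x)"
      then obtain z where z: "z \<in> fst (T y \<sqinter>\<^bsub>L\<^esub> M x)" "(z, y) \<in> arr"
        using not_snd[OF Pairs_meet_closed[OF Ty Mx] yS] by blast
      then have "(y, z) \<in> tw" "(z, x) \<notin> arr"
        by (auto simp: fst_meet_Pairs[OF Ty Mx] fst_M[OF xS] fst_T)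
      then show False using z(2) tw_arr_eq tw tw_arr by blast
    qed
    ultimately show ?thesis by (rule label_contracted)
  qed
qed

lemma contracted_set_downset:
  "contracted_set S arr tw \<Theta> \<in> carrier (downsets S (leadsto S tw hk))"
  using contracted_leadsto by (auto simp: downsets_def contracted_set_iff)

lemma congI_of_meet:
  assumes "(p \<sqinter>\<^bsub>L\<^esub> q, p) \<in> \<Theta>" "(p \<sqinter>\<^bsub>L\<^esub> q, q) \<in> \<Theta>"
  shows "(p, q) \<in> \<Theta>"
  using assms cong_sym cong_trans by blast

text \<open>Cover-determinedness reduces the claim to covers between \<open>p\<close> and
  \<open>q\<close>. The label of such a cover lies in \<open>fst q\<close> but not in
  \<open>fst p\<close>, hence is contracted, and so is the cover.\<close>

lemma cong_of_contracted:
  assumes cd: "cover_determined L \<Theta>"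
    and p: "p \<in> carrier L" and q: "q \<in> carrier L" and le: "fst p \<subseteq> fst q"
    and sub: "fst q - fst p \<subseteq> contracted_set S arr tw \<Theta>"
  shows "(p, q) \<in> \<Theta>"
proof -
  have "(b, a) \<in> \<Theta>"
    if cov: "covered_by L b a" and pb: "fst p \<subseteq> fst b" and aq: "fst a \<subseteq> fst q" for b a
  proof -
    have bc: "b \<in> carrier L" using cov by (simp add: covered_by_def)
    obtain w where w: "w \<in> fst a" "w \<in> snd b" "b \<squnion>\<^bsub>L\<^esub> T w = a" "b \<squnion>\<^bsub>L\<^esub> Ts w = b"
      using cover_label[OF cov] .
    have "w \<in> contracted_set S arr tw \<Theta>"
      using w(1,2) pb aq sub Pairs_disjoint[OF bc] by blast
    then have "(b \<squnion>\<^bsub>L\<^esub> Ts w, b \<squnion>\<^bsub>L\<^esub> T w) \<in> \<Theta>"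
      by (intro cong_join cong_refl bc) (simp add: contracted_set_iff)
    then show ?thesis by (simp add: w)
  qed
  then show ?thesis using cd p q le unfolding cover_determined_def by simp
qed

end

end

section \<open>The congruence attached to a downset\<close>

text \<open>Comparing first components makes compatibility with meets immediate for any
  \<open>D\<close>. Compatibility with joins comes from the form in second components,
  \<open>agree_outside_iff_snd\<close>, where \<open>D\<close> is a downset.\<close>

definition agree_outside :: "'a set \<Rightarrow> 'a rel \<Rightarrow> 'a set \<Rightarrow> ('a set \<times> 'a set) rel" where
  "agree_outside S arr D = {(p, q). p \<in> carrier (Pairs S arr) \<and> q \<in> carrier (Pairs S arr) \<and>
     fst p - D = fst q - D}"

locale image_factorization_system = two_acyclic_factorization_system +
  assumes img: "image_condition S arr tw hk"
begin

text \<open>An image \<open>w\<close> stays minimal in the larger set \<open>F_set S hk z\<close>: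
  whatever lies \<open>tw\<close>-below \<open>w\<close> is also \<open>tw\<close>-below
  \<open>x\<close>. Hence \<open>w \<leadsto> z\<close>. Dually, a co-image satisfies
  \<open>w \<leadsto> x\<close>.\<close>

lemma obtain_image:
  assumes "(x, z) \<in> arr"
  obtains w where "(x, w) \<in> tw" "(w, z) \<in> hk" "(w, z) \<in> leadsto S tw hk"
proof -
  have xz: "x \<in> S" "z \<in> S" using arr_dom assms by auto
  then obtain w where w: "minimal_in tw (between S tw hk x z) w"
    using img assms by (auto simp: image_condition_def)
  then have wxz: "w \<in> S" "(x, w) \<in> tw" "(w, z) \<in> hk"
    by (auto simp: minimal_in_def between_def)
  have "minimal_in tw (F_set S hk z) w"
    using w wxz tw_trans[OF wxz(2)] unfolding minimal_in_def F_set_def between_def by blast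
  then show ?thesis using that wxz xz by (auto simp: leadsto_def)
qed

lemma obtain_coimage:
  assumes "(x, z) \<in> arr"
  obtains w where "(x, w) \<in> tw" "(w, z) \<in> hk" "(w, x) \<in> leadsto S tw hk"
proof -
  have xz: "x \<in> S" "z \<in> S" using arr_dom assms by auto
  then obtain w where w: "maximal_in hk (between S tw hk x z) w"
    using img assms by (auto simp: image_condition_def)
  then have wxz: "w \<in> S" "(x, w) \<in> tw" "(w, z) \<in> hk"
    by (auto simp: maximal_in_def between_def)
  have "maximal_in hk (T_set S tw x) w"
    using w wxz hk_trans[OF _ wxz(3)] unfolding maximal_in_def T_set_def between_def by blast
  then show ?thesis using that wxz xz by (auto simp: leadsto_def)
qed

text \<open>By two-acyclicity \<open>x\<close> is \<open>tw\<close>-minimal in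
  \<open>F_set S hk x\<close>. Thus the transitive closure is already reflexive, as a forcing
  preorder must be.\<close>

lemma leadsto_refl: "x \<in> S \<Longrightarrow> (x, x) \<in> leadsto S tw hk"
  by (auto simp: leadsto_def minimal_in_def F_set_def hk_refl dest: tw_hk_eq)

context
  fixes D
  assumes D: "D \<in> carrier (downsets S (leadsto S tw hk))"
begin

lemma downset_sub: "D \<subseteq> S"
  and downsetD: "(x, y) \<in> leadsto S tw hk \<Longrightarrow> y \<notin> D \<Longrightarrow> x \<notin> D"
  using D by (auto simp: downsets_def)

text \<open>Some \<open>x\<close> in \<open>fst q\<close> has an arrow to \<open>y\<close>. An image
  \<open>w\<close> of it lies in \<open>fst q\<close> and in \<open>snd p\<close>, and
  \<open>w \<leadsto> y\<close> keeps \<open>w\<close> outside the downset.\<close>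

lemma separate_snd:
  assumes p: "p \<in> carrier L" and q: "q \<in> carrier L"
    and y: "y \<in> snd p" "y \<notin> snd q" "y \<notin> D"
  obtains w where "w \<in> fst q" "w \<in> snd p" "w \<notin> D"
proof -
  obtain x where x: "x \<in> fst q" "(x, y) \<in> arr"
    using not_snd[OF q _ y(2)] Pairs_sub(2)[OF p] y(1) by auto
  obtain w where "(x, w) \<in> tw" "(w, y) \<in> hk" "(w, y) \<in> leadsto S tw hk"
    using obtain_image[OF x(2)] .
  then show ?thesis
    using that fst_tw_closed[OF q x(1)] snd_hk_closed[OF p y(1)] downsetD y(3) by blast
qed

text \<open>A co-image \<open>v\<close> of an arrow from \<open>x\<close> to \<open>snd p\<close> is
  in \<open>snd p\<close> but not in \<open>snd q\<close>, and \<open>v \<leadsto> x\<close> keeps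
  it outside \<open>D\<close>. This reduces the claim to \<open>separate_snd\<close>.\<close>

lemma separate_fst:
  assumes p: "p \<in> carrier L" and q: "q \<in> carrier L"
    and x: "x \<in> fst q" "x \<notin> fst p" "x \<notin> D"
  obtains w where "w \<in> fst q" "w \<in> snd p" "w \<notin> D"
proof -
  obtain y where y: "y \<in> snd p" "(x, y) \<in> arr"
    using not_fst[OF p _ x(2)] Pairs_sub(1)[OF q] x(1) by auto
  obtain v where v: "(x, v) \<in> tw" "(v, y) \<in> hk" "(v, x) \<in> leadsto S tw hk"
    using obtain_coimage[OF y(2)] .
  have "v \<in> snd p" using snd_hk_closed[OF p y(1) v(2)] .
  moreover have "v \<notin> snd q" using fst_tw_closed[OF q x(1) v(1)] Pairs_disjoint[OF q] by blast
  moreover have "v \<notin> D" using downsetD v(3) x(3) by blast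
  ultimately show ?thesis using separate_snd[OF p q] that by blast
qed

text \<open>Each inclusion says that no \<open>w\<close> outside \<open>D\<close> lies in both
  \<open>fst q\<close> and \<open>snd p\<close>: such a \<open>w\<close> refutes both, and a failure
  of either one produces it.\<close>

lemma agree_fst_iff_snd:
  assumes p: "p \<in> carrier L" and q: "q \<in> carrier L"
  shows "fst q - D \<subseteq> fst p \<longleftrightarrow> snd p - D \<subseteq> snd q"
proof
  assume f: "fst q - D \<subseteq> fst p"
  show "snd p - D \<subseteq> snd q"
  proof
    fix y assume y: "y \<in> snd p - D"
    show "y \<in> snd q"
    proof (rule ccontr)
      assume "y \<notin> snd q"
      then obtain w where "w \<in> fst q" "w \<in> snd p" "w \<notin> D" using separate_snd[OF p q] y by blast
      then show False using f Pairs_disjoint[OF p] by blast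
    qed
  qed
next
  assume f: "snd p - D \<subseteq> snd q"
  show "fst q - D \<subseteq> fst p"
  proof
    fix x assume x: "x \<in> fst q - D"
    show "x \<in> fst p"
    proof (rule ccontr)
      assume "x \<notin> fst p"
      then obtain w where "w \<in> fst q" "w \<in> snd p" "w \<notin> D" using separate_fst[OF p q] x by blast
      then show False using f Pairs_disjoint[OF q] by blast
    qed
  qed
qed

lemma agree_outside_iff_snd:
  "(p, q) \<in> agree_outside S arr D \<longleftrightarrow> p \<in> carrier L \<and> q \<in> carrier L \<and> snd p - D = snd q - D"
  using agree_fst_iff_snd[of p q] agree_fst_iff_snd[of q p] by (auto simp: agree_outside_def)

lemma agree_outside_inf:
  assumes K: "K \<subseteq> agree_outside S arr D"
  shows "(\<Sqinter>\<^bsub>L\<^esub> (fst ` K), \<Sqinter>\<^bsub>L\<^esub> (snd ` K)) \<in> agree_outside S arr D"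
proof -
  interpret L: complete_lattice L by (rule complete_lattice_Pairs)
  have c: "fst ` K \<subseteq> carrier L" "snd ` K \<subseteq> carrier L"
    using K by (auto simp: agree_outside_def)
  have "fst (fst k) - D = fst (snd k) - D" if "k \<in> K" for k
    using subsetD[OF K that] by (auto simp: agree_outside_def)
  then have "(S \<inter> \<Inter> (fst ` fst ` K)) - D = (S \<inter> \<Inter> (fst ` snd ` K)) - D"
    by blast
  then show ?thesis
    using c by (simp add: agree_outside_def fst_inf_Pairs)
qed

lemma agree_outside_sup:
  assumes K: "K \<subseteq> agree_outside S arr D"
  shows "(\<Squnion>\<^bsub>L\<^esub> (fst ` K), \<Squnion>\<^bsub>L\<^esub> (snd ` K)) \<in> agree_outside S arr D"
proof -
  interpret L: complete_lattice L by (rule complete_lattice_Pairs)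
  have c: "fst ` K \<subseteq> carrier L" "snd ` K \<subseteq> carrier L"
    using K by (auto simp: agree_outside_def)
  have "snd (fst k) - D = snd (snd k) - D" if "k \<in> K" for k
    using subsetD[OF K that] agree_outside_iff_snd[of "fst k" "snd k"] by simp
  then have "(S \<inter> \<Inter> (snd ` fst ` K)) - D = (S \<inter> \<Inter> (snd ` snd ` K)) - D"
    by blast
  then show ?thesis
    using c by (simp add: agree_outside_iff_snd snd_sup_Pairs)
qed

lemma agree_outside_complete_congruence: "complete_congruence L (agree_outside S arr D)"
proof -
  have "equiv (carrier L) (agree_outside S arr D)"
    by (rule equivI) (auto simp: agree_outside_def refl_on_def sym_def trans_def)
  moreover have "(p \<squnion>\<^bsub>L\<^esub> q, p' \<squnion>\<^bsub>L\<^esub> q') \<in> agree_outside S arr D"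
    and "(p \<sqinter>\<^bsub>L\<^esub> q, p' \<sqinter>\<^bsub>L\<^esub> q') \<in> agree_outside S arr D"
    if "(p, p') \<in> agree_outside S arr D" "(q, q') \<in> agree_outside S arr D" for p p' q q'
    using agree_outside_inf[of "{(p, p'), (q, q')}"] agree_outside_sup[of "{(p, p'), (q, q')}"] that
    by (simp_all add: join_def meet_def)
  ultimately show ?thesis
    using agree_outside_inf agree_outside_sup
    by (simp add: complete_congruence_def lattice_congruence_def)
qed

text \<open>If \<open>p\<close> and \<open>q\<close> disagree outside \<open>D\<close>, a separating
  \<open>w\<close> outside \<open>D\<close> labels a cover between them, and the ends of that cover
  already disagree at \<open>w\<close>.\<close>

lemma agree_outside_cover_determined: "cover_determined L (agree_outside S arr D)"
  unfolding cover_determined_def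
proof (intro ballI impI)
  fix p q assume p: "p \<in> carrier L" and q: "q \<in> carrier L" and le: "p \<sqsubseteq>\<^bsub>L\<^esub> q"
    and cov: "\<forall>u v. covered_by L u v \<longrightarrow> p \<sqsubseteq>\<^bsub>L\<^esub> u \<longrightarrow> v \<sqsubseteq>\<^bsub>L\<^esub> q \<longrightarrow> (u, v) \<in> agree_outside S arr D"
  have "fst q - D \<subseteq> fst p"
  proof
    fix x assume x: "x \<in> fst q - D"
    show "x \<in> fst p"
    proof (rule ccontr)
      assume "x \<notin> fst p"
      then obtain w where w: "w \<in> fst q" "w \<in> snd p" "w \<notin> D" using separate_fst[OF p q] x by blast
      have wS: "w \<in> S" using w(1) Pairs_sub(1)[OF q] by auto
      note lc = labelled_cover[OF p w(2)]
      have "fst (p \<squnion>\<^bsub>L\<^esub> T w) \<subseteq> fst q"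
        using le T_le[OF q w(1)] by (intro fst_join_Pairs_least[OF p T_closed[OF wS] q]) auto
      then have "((p \<squnion>\<^bsub>L\<^esub> T w) \<sqinter>\<^bsub>L\<^esub> M w, p \<squnion>\<^bsub>L\<^esub> T w) \<in> agree_outside S arr D"
        using cov lc(1,2) Pairs_simps(1) by blast
      then show False using lc(4,5) w(3) by (auto simp: agree_outside_def)
    qed
  qed
  then show "(p, q) \<in> agree_outside S arr D" using p q le by (auto simp: agree_outside_def)
qed

lemma agree_outside_Con_cc: "agree_outside S arr D \<in> carrier (Con_cc L)"
  using agree_outside_complete_congruence agree_outside_cover_determined by simp

text \<open>The first components of \<open>T x\<close> and \<open>Ts x\<close> differ exactly in
  \<open>x\<close>.\<close>

lemma contracted_set_agree_outside: "contracted_set S arr tw (agree_outside S arr D) = D"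
proof -
  have "(Ts x, T x) \<in> agree_outside S arr D \<longleftrightarrow> x \<in> D" if "x \<in> S" for x
    using that T_closed T_star_closed tw_refl[OF that]
    by (auto simp: agree_outside_def fst_T fst_T_star)
  then show ?thesis using downset_sub by (auto simp: contracted_set_iff)
qed

end

section \<open>Downsets, congruences and forcing\<close>

text \<open>A congruent pair that disagrees outside the contracted set would have a separating label
  outside it, against \<open>label_contracted\<close>. The other inclusion is where
  cover-determinedness enters, through \<open>cong_of_contracted\<close>.\<close>

lemma Con_cc_eq_agree_outside:
  assumes \<Theta>: "\<Theta> \<in> carrier (Con_cc L)"
  shows "\<Theta> = agree_outside S arr (contracted_set S arr tw \<Theta>)" (is "_ = agree_outside S arr ?D")
proof -
  have cong: "lattice_congruence L \<Theta>" and cd: "cover_determined L \<Theta>"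
    using \<Theta> by (auto simp: complete_congruence_def)
  note D = contracted_set_downset[OF cong]
  have sub: "fst q - ?D \<subseteq> fst p" if pq: "(p, q) \<in> \<Theta>" for p q
  proof
    fix x assume x: "x \<in> fst q - ?D"
    have pc: "p \<in> carrier L" and qc: "q \<in> carrier L" using cong_closed[OF cong pq] by auto
    show "x \<in> fst p"
    proof (rule ccontr)
      assume "x \<notin> fst p"
      then obtain w where "w \<in> fst q" "w \<in> snd p" "w \<notin> ?D"
        using separate_fst[OF D pc qc] x by blast
      then show False using label_contracted[OF cong pq] by blast
    qed
  qed
  have "(p, q) \<in> \<Theta>" if pq: "(p, q) \<in> agree_outside S arr ?D" for p q
  proof -
    have p: "p \<in> carrier L" and q: "q \<in> carrier L" and eq: "fst p - ?D = fst q - ?D"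
      using pq by (auto simp: agree_outside_def)
    note m = Pairs_meet_closed[OF p q]
    show ?thesis
      \<comment> \<open>Going through the meet makes the pairs comparable; \<open>fst p\<close> and
        \<open>fst q\<close> exceed their intersection only by contracted elements.\<close>
      by (rule congI_of_meet[OF cong]; rule cong_of_contracted[OF cong cd m])
        (use p q eq in \<open>auto simp: fst_meet_Pairs[OF p q]\<close>)
  qed
  moreover have "(p, q) \<in> agree_outside S arr ?D" if pq: "(p, q) \<in> \<Theta>" for p q
    using sub[OF pq] sub[OF cong_sym[OF cong pq]] cong_closed[OF cong pq]
    by (auto simp: agree_outside_def)
  ultimately show ?thesis by auto
qed

text \<open>Existence and uniqueness in one equivalence, so that the definite description in
  \<open>downset_congruence\<close> evaluates to \<open>agree_outside S arr D\<close>.\<close>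

lemma Con_cc_contracted_set_iff:
  assumes D: "D \<in> carrier (downsets S (leadsto S tw hk))"
  shows "\<Theta> \<in> carrier (Con_cc L) \<and> contracted_set S arr tw \<Theta> = D \<longleftrightarrow> \<Theta> = agree_outside S arr D"
  using agree_outside_Con_cc[OF D] contracted_set_agree_outside[OF D] Con_cc_eq_agree_outside
  by blast

lemma contracted_set_Con_cc:
  assumes "\<Theta> \<in> carrier (Con_cc L)"
  shows "contracted_set S arr tw \<Theta> \<in> carrier (downsets S (leadsto S tw hk))"
  using assms contracted_set_downset by (simp add: complete_congruence_def)

lemma downset_congruence_eq:
  assumes "D \<in> carrier (downsets S (leadsto S tw hk))"
  shows "downset_congruence S arr tw D = agree_outside S arr D"
  unfolding downset_congruence_def Con_cc_contracted_set_iff[OF assms] by simp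

lemma bij_downset_congruence:
  "bij_betw (downset_congruence S arr tw)
     (carrier (downsets S (leadsto S tw hk))) (carrier (Con_cc L))"
proof (rule bij_betw_byWitness[where f' = "contracted_set S arr tw"])
  show "\<forall>D\<in>carrier (downsets S (leadsto S tw hk)).
      contracted_set S arr tw (downset_congruence S arr tw D) = D"
    by (simp add: downset_congruence_eq contracted_set_agree_outside)
  show "\<forall>\<Theta>\<in>carrier (Con_cc L). downset_congruence S arr tw (contracted_set S arr tw \<Theta>) = \<Theta>"
    using downset_congruence_eq[OF contracted_set_Con_cc] Con_cc_eq_agree_outside by metis
  show "downset_congruence S arr tw ` carrier (downsets S (leadsto S tw hk)) \<subseteq> carrier (Con_cc L)"
    using downset_congruence_eq agree_outside_Con_cc by (metis image_subsetI)
  show "contracted_set S arr tw ` carrier (Con_cc L) \<subseteq> carrier (downsets S (leadsto S tw hk))"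
    using contracted_set_Con_cc by blast
qed

text \<open>For the direction from congruences to downsets, contracted sets grow with the congruence
  and give back \<open>D\<close> and \<open>E\<close>.\<close>

lemma agree_outside_mono_iff:
  assumes D: "D \<in> carrier (downsets S (leadsto S tw hk))"
    and E: "E \<in> carrier (downsets S (leadsto S tw hk))"
  shows "agree_outside S arr D \<subseteq> agree_outside S arr E \<longleftrightarrow> D \<subseteq> E"
proof
  assume "agree_outside S arr D \<subseteq> agree_outside S arr E"
  then have "contracted_set S arr tw (agree_outside S arr D) \<subseteq>
      contracted_set S arr tw (agree_outside S arr E)"
    by (auto simp: contracted_set_iff)
  then show "D \<subseteq> E" by (simp add: contracted_set_agree_outside D E)
next
  assume "D \<subseteq> E"
  then show "agree_outside S arr D \<subseteq> agree_outside S arr E"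
    unfolding agree_outside_def by blast
qed

lemma cd_forcing_iff:
  assumes x: "x \<in> S" and y: "y \<in> S"
  shows "(T x, T y) \<in> cd_forcing L \<longleftrightarrow> (x, y) \<in> (leadsto S tw hk)\<^sup>+"
proof -
  let ?R = "leadsto S tw hk"
  have "(T x, T y) \<in> cd_forcing L \<longleftrightarrow>
      (\<forall>\<Theta>\<in>carrier (Con_cc L).
        x \<in> contracted_set S arr tw \<Theta> \<longrightarrow> y \<in> contracted_set S arr tw \<Theta>)"
    using x y by (simp add: cd_forcing_def Ji_c_Pairs lower_cover_T contracted_set_def)
  \<comment> \<open>The contracted sets of members of \<open>Con_cc L\<close> are exactly the
    downsets.\<close>
  also have "\<dots> \<longleftrightarrow> (\<forall>D\<in>carrier (downsets S ?R). x \<in> D \<longrightarrow> y \<in> D)"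
    using contracted_set_Con_cc agree_outside_Con_cc contracted_set_agree_outside by metis
  also have "\<dots> \<longleftrightarrow> (x, y) \<in> ?R\<^sup>+"
  proof
    assume all: "\<forall>D\<in>carrier (downsets S ?R). x \<in> D \<longrightarrow> y \<in> D"
    have "{z. (x, z) \<in> ?R\<^sup>+} \<subseteq> S" by (auto simp: leadsto_def elim: tranclE)
    then have "{z. (x, z) \<in> ?R\<^sup>+} \<in> carrier (downsets S ?R)"
      by (auto simp: downsets_def intro: trancl_into_trancl)
    \<comment> \<open>The test downset is the one generated by \<open>x\<close>; reflexivity of
      \<open>leadsto\<close> puts \<open>x\<close> itself into it.\<close>
    moreover have "x \<in> {z. (x, z) \<in> ?R\<^sup>+}" using leadsto_refl[OF x] by simp
    ultimately have "y \<in> {z. (x, z) \<in> ?R\<^sup>+}" by (rule all[rule_format])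
    then show "(x, y) \<in> ?R\<^sup>+" by simp
  next
    assume xy: "(x, y) \<in> ?R\<^sup>+"
    show "\<forall>D\<in>carrier (downsets S ?R). x \<in> D \<longrightarrow> y \<in> D"
    proof (intro ballI impI)
      fix D assume D: "D \<in> carrier (downsets S ?R)" "x \<in> D"
      show "y \<in> D" using xy D by (induction rule: trancl_induct) (auto simp: downsets_def)
    qed
  qed
  finally show ?thesis .
qed

end

lemma weak_partial_order_downsets: "weak_partial_order (downsets S r)"
  by unfold_locales (auto simp: downsets_def)

theorem corollary6p15:
  fixes S :: "'a set" and arr tw hk :: "'a rel"
  assumes "factorization_system S arr tw hk"
    and "two_acyclic S tw hk"
    and "image_condition S arr tw hk"
  shows
    "bij_betw (T_pair S arr tw) S (Ji_c (Pairs S arr)) \<and>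
     (\<forall>x\<in>S. \<forall>y\<in>S.
        (x, y) \<in> (leadsto S tw hk)\<^sup>+ \<longleftrightarrow>
        (T_pair S arr tw x, T_pair S arr tw y) \<in> cd_forcing (Pairs S arr)) \<and>
     (\<forall>D\<in>carrier (downsets S (leadsto S tw hk)).
        \<exists>!\<Theta>. \<Theta> \<in> carrier (Con_cc (Pairs S arr)) \<and> contracted_set S arr tw \<Theta> = D) \<and>
     bij_betw (downset_congruence S arr tw)
       (carrier (downsets S (leadsto S tw hk))) (carrier (Con_cc (Pairs S arr))) \<and>
     order_emb (downsets S (leadsto S tw hk)) (Con_cc (Pairs S arr)) (downset_congruence S arr tw)"
proof -
  interpret image_factorization_system S arr tw hk
    using assms by unfold_locales
  have le: "D \<sqsubseteq>\<^bsub>downsets S (leadsto S tw hk)\<^esub> E \<longleftrightarrow> D \<subseteq> E" for D E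
    by (simp add: downsets_def)
  have "order_emb (downsets S (leadsto S tw hk)) (Con_cc L) (downset_congruence S arr tw)"
    using partial_order.axioms(1)[OF partial_order_Con_cc[of L]]
    by (auto simp: order_emb_def le downset_congruence_eq agree_outside_mono_iff
        weak_partial_order_downsets)
  moreover have "\<forall>D\<in>carrier (downsets S (leadsto S tw hk)).
      \<exists>!\<Theta>. \<Theta> \<in> carrier (Con_cc L) \<and> contracted_set S arr tw \<Theta> = D"
    by (metis Con_cc_contracted_set_iff)
  ultimately show ?thesis
    using T_inj Ji_c_Pairs cd_forcing_iff bij_downset_congruence
    by (simp add: bij_betw_def)
qed

end
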